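(* There exists an absolute constant $c>0$ such that for every $\varepsilon>0$ and every integer $k\ge c/\varepsilon$ there is a constant $C(k)$ depending only on $k$ such that the following holds whenever $q\ge n^{1+\varepsilon}$: for every $v\in[n]^2$ and every $\alpha\in\{(0,\pm1),(\pm1,0)\}$, $$\mathbb P\big[\exists f\in S_k(v)\ \text{with}\ f(\alpha)\neq v+\alpha\big]\le C(k)\,n^{-2-\varepsilon/2}.$$
   Context: Let $n,q$ be positive integers, $[m]=\{1,\dots,m\}$, $[a,b]=\{a,a+1,\dots,b\}$. Every vertex $v\in[n]^2$ has four incident edges $\uparrow(v),\downarrow(v),\rightarrow(v),\leftarrow(v)$, where $\rightarrow(i,j)=\leftarrow(i+1,j)$ is the edge between $(i,j)$ and $(i+1,j)$ and $\uparrow(i,j)=\downarrow(i,j+1)$ is the edge between $(i,j)$ and $(i,j+1)$; for boundary vertices the edges leading out of $[n]^2$ are included. A random puzzle is a coloring $\sigma$ of all these edges (including boundary edges) by independent uniform colors in $[q]$. For $v\in[n]^2$ and an integer $k\ge1$, $S_k(v)$ is the (random) set of injective maps $f:[-k,k]^2\to[n]^2$ with $f(0,0)=v$ that are feasible, i.e. $\sigma(\rightarrow(f(i,j)))=\sigma(\leftarrow(f(i+1,j)))$ whenever $(i,j),(i+1,j)\in[-k,k]^2$ and $\sigma(\uparrow(f(i,j)))=\sigma(\downarrow(f(i,j+1)))$ whenever $(i,j),(i,j+1)\in[-k,k]^2$. *)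

theory Defs
  imports Complex_Main "HOL-Library.FuncSet"
begin

type_synonym vtx = "int \<times> int"
(* edges: (True,i,j) = edge between (i,j) and (i+1,j);  (False,i,j) = edge between (i,j) and (i,j+1) *)
type_synonym edge = "bool \<times> int \<times> int"

definition grid :: "nat \<Rightarrow> vtx set" where
  "grid n = {1..int n} \<times> {1..int n}"

definition eright :: "vtx \<Rightarrow> edge" where "eright v = (True, fst v, snd v)"
definition eleft  :: "vtx \<Rightarrow> edge" where "eleft v = (True, fst v - 1, snd v)"
definition eup    :: "vtx \<Rightarrow> edge" where "eup v = (False, fst v, snd v)"
definition edown  :: "vtx \<Rightarrow> edge" where "edown v = (False, fst v, snd v - 1)"

(* all edges incident to vertices of [n]^2, including boundary edges *)
definition edges :: "nat \<Rightarrow> edge set" where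
  "edges n = {(True, i, j) | i j. 0 \<le> i \<and> i \<le> int n \<and> 1 \<le> j \<and> j \<le> int n}
           \<union> {(False, i, j) | i j. 1 \<le> i \<and> i \<le> int n \<and> 0 \<le> j \<and> j \<le> int n}"

definition colourings :: "nat \<Rightarrow> nat \<Rightarrow> (edge \<Rightarrow> nat) set" where
  "colourings n q = edges n \<rightarrow>\<^sub>E {1..q}"

definition box :: "nat \<Rightarrow> vtx set" where
  "box k = {-int k..int k} \<times> {-int k..int k}"

definition feasible :: "nat \<Rightarrow> (edge \<Rightarrow> nat) \<Rightarrow> (vtx \<Rightarrow> vtx) \<Rightarrow> bool" where
  "feasible k \<sigma> f \<longleftrightarrow>
     (\<forall>i j. (i, j) \<in> box k \<and> (i + 1, j) \<in> box k \<longrightarrow>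
        \<sigma> (eright (f (i, j))) = \<sigma> (eleft (f (i + 1, j)))) \<and>
     (\<forall>i j. (i, j) \<in> box k \<and> (i, j + 1) \<in> box k \<longrightarrow>
        \<sigma> (eup (f (i, j))) = \<sigma> (edown (f (i, j + 1))))"

definition Sk :: "nat \<Rightarrow> nat \<Rightarrow> (edge \<Rightarrow> nat) \<Rightarrow> vtx \<Rightarrow> (vtx \<Rightarrow> vtx) set" where
  "Sk n k \<sigma> v = {f \<in> box k \<rightarrow>\<^sub>E grid n. inj_on f (box k) \<and> f (0, 0) = v \<and> feasible k \<sigma> f}"

definition directions :: "vtx set" where
  "directions = {(0, 1), (0, -1), (1, 0), (-1, 0)}"

definition puzzle_prob :: "nat \<Rightarrow> nat \<Rightarrow> ((edge \<Rightarrow> nat) \<Rightarrow> bool) \<Rightarrow> real" where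
  "puzzle_prob n q E = real (card {\<sigma> \<in> colourings n q. E \<sigma>}) / real (card (colourings n q))"

end

theory Submission
  imports Defs "HOL-Library.Product_Plus"
begin

text \<open>
  Fix a feasible \<open>f\<close>. Each adjacency of the box forces two edge colours to agree; for a set of \<open>r\<close>
  independent such constraints this has probability \<open>q\<^sup>-\<^sup>r\<close>. Group the box into clusters, pieces whose
  images are linked by adjacencies in the grid: if \<open>m\<close> clusters meet a sub-box, then \<open>f\<close> can be
  chosen there in \<open>O(n\<^sup>2\<^sup>(\<^sup>m\<^sup>-\<^sup>1\<^sup>))\<close> ways. So it suffices to find, for each bad \<open>f\<close>, a
  sub-box with \<open>2(m - 1) - (1 + \<epsilon>) r \<le> -2 - \<epsilon>/2\<close>.

  Since \<open>a\<close> cells of the square lattice span at most \<open>2a - 2 \<surd>a\<close> adjacencies, the whole box, of side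
  \<open>L = 2k + 1\<close>, has \<open>r \<ge> 2 \<Sum> \<surd>a\<^sub>i - 2L\<close>, the \<open>a\<^sub>i\<close> being the cluster sizes. This suffices if
  \<open>\<epsilon>r \<ge> 4L\<close>; otherwise there are few clusters, and it still suffices unless one cluster is giant.
  If a giant cluster covers the \<open>3 \<times> 3\<close> box at the centre, then three edge-disjoint paths between
  the centre and its wrong neighbour give two independent constraints, at no cost in placements. If it
  does not, let \<open>A\<^sub>j\<close> be the part of the box of radius \<open>j\<close> outside the giant cluster. The constraints
  meeting \<open>A\<^sub>j\<close> suffice unless more than \<open>2 \<surd>|A\<^sub>j| - 2\<close> edges leave the box from \<open>A\<^sub>j\<close>; if this happens
  for all \<open>j \<le> k\<close>, then \<open>|A\<^sub>j|\<close> grows quadratically and leaves no room for the giant cluster.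
\<close>

section \<open>Colour constraints imposed by a map of the box\<close>

definition stp :: "bool \<Rightarrow> vtx" where
  "stp d = (if d then (1, 0) else (0, 1))"

text \<open>
  A link \<open>(d, x)\<close> stands for the adjacency of \<open>x\<close> and \<open>x + stp d\<close> in the box; feasibility of \<open>f\<close>
  means that the edges \<open>src f (d, x)\<close> and \<open>tgt f (d, x)\<close> have the same colour.
\<close>

definition src :: "(vtx \<Rightarrow> vtx) \<Rightarrow> bool \<times> vtx \<Rightarrow> edge" where
  "src f c = (fst c, f (snd c))"

definition tgt :: "(vtx \<Rightarrow> vtx) \<Rightarrow> bool \<times> vtx \<Rightarrow> edge" where
  "tgt f c = (fst c, f (snd c + stp (fst c)) - stp (fst c))"

text \<open>
  The colours of the private edges \<open>p c\<close> are determined by the others, hence a factor \<open>q\<close> is gained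
  for every constraint.
\<close>

definition indep :: "(vtx \<Rightarrow> vtx) \<Rightarrow> (bool \<times> vtx) set \<Rightarrow> bool" where
  "indep f I \<longleftrightarrow> (\<exists>p. \<forall>c\<in>I. src f c \<noteq> tgt f c \<and> p c \<in> {src f c, tgt f c} \<and>
      (\<forall>c'\<in>I. c' \<noteq> c \<longrightarrow> p c \<notin> {src f c', tgt f c'}))"

definition links :: "vtx set \<Rightarrow> (bool \<times> vtx) set" where
  "links X = {(d, x). x \<in> X \<and> x + stp d \<in> X}"

lemma feasible_links:
  assumes "feasible k \<sigma> f" "c \<in> links (box k)"
  shows "\<sigma> (src f c) = \<sigma> (tgt f c)"
proof -
  obtain d i j where c: "c = (d, i, j)" by (cases c) auto
  have m: "eright u = (True, u)" "eup u = (False, u)"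
    "eleft u = (True, u - (1, 0))" "edown u = (False, u - (0, 1))" for u
    by (auto simp: eright_def eleft_def eup_def edown_def prod_eq_iff)
  show ?thesis
    using assms by (cases d) (auto simp: c feasible_def links_def src_def tgt_def stp_def m)
qed

lemma links_mono: "X \<subseteq> Y \<Longrightarrow> links X \<subseteq> links Y"
  by (auto simp: links_def)

lemma finite_links: "finite X \<Longrightarrow> finite (links X)"
  by (rule finite_subset[of _ "UNIV \<times> X"]) (auto simp: links_def)

lemma finite_box [simp]: "finite (box k)"
  by (simp add: box_def)

lemma card_box: "card (box k) = (2 * k + 1)^2"
proof -
  have "nat (int k + 1 + int k) = 2 * k + 1" by simp
  then show ?thesis by (simp add: box_def card_cartesian_product power2_eq_square)
qed

lemma box_mono: "j \<le> k \<Longrightarrow> box j \<subseteq> box k"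
  by (auto simp: box_def)

lemma zero_in_box [simp]: "0 \<in> box k"
  by (auto simp: box_def zero_prod_def)

lemma finite_grid [simp]: "finite (grid n)"
  by (simp add: grid_def)

lemma card_grid: "card (grid n) = n^2"
  by (simp add: grid_def card_cartesian_product power2_eq_square)

lemma finite_edges [simp]: "finite (edges n)"
  by (rule finite_subset[of _ "UNIV \<times> {0..int n} \<times> {0..int n}"]) (auto simp: edges_def)

lemma src_tgt_edges:
  assumes "c \<in> links X" "h ` X \<subseteq> grid n"
  shows "src h c \<in> edges n" "tgt h c \<in> edges n"
proof -
  obtain d x where c: "c = (d, x)" by (cases c)
  have "h x \<in> grid n" "h (x + stp d) \<in> grid n"
    using assms by (auto simp: links_def c)
  then show "src h c \<in> edges n" "tgt h c \<in> edges n"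
    by (cases "h x"; cases "h (x + stp d)"; cases d;
        auto simp: c src_def tgt_def edges_def grid_def stp_def)+
qed

lemma card_colourings: "card (colourings n q) = q ^ card (edges n)"
  by (simp add: colourings_def card_PiE)

lemma card_indep_colourings:
  assumes I: "indep h I" "I \<subseteq> links X" "finite X" and h: "h ` X \<subseteq> grid n"
  shows "card {\<sigma> \<in> colourings n q. \<forall>c\<in>I. \<sigma> (src h c) = \<sigma> (tgt h c)} * q ^ card I
    \<le> card (colourings n q)"
proof -
  let ?S = "{\<sigma> \<in> colourings n q. \<forall>c\<in>I. \<sigma> (src h c) = \<sigma> (tgt h c)}"
  obtain p where p: "\<And>c. c \<in> I \<Longrightarrow> src h c \<noteq> tgt h c \<and> p c \<in> {src h c, tgt h c}"
    and priv: "\<And>c c'. c \<in> I \<Longrightarrow> c' \<in> I \<Longrightarrow> c' \<noteq> c \<Longrightarrow> p c \<notin> {src h c', tgt h c'}"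
    using I(1) unfolding indep_def by blast
  have finI: "finite I" using I finite_links finite_subset by blast
  have inj: "inj_on p I" using p priv by (metis inj_onI)
  have pE: "p ` I \<subseteq> edges n"
    using p src_tgt_edges[OF _ h] I(2) by (auto; metis subsetD)
  let ?E = "edges n - p ` I"
  have "inj_on (\<lambda>\<sigma>. restrict \<sigma> ?E) ?S"
  proof (rule inj_onI)
    fix \<sigma> \<tau> assume s: "\<sigma> \<in> ?S" and t: "\<tau> \<in> ?S" and eq: "restrict \<sigma> ?E = restrict \<tau> ?E"
    have eqE: "\<sigma> e = \<tau> e" if "e \<in> ?E" for e
      using eq that by (metis restrict_apply')
    have eqp: "\<sigma> (p c) = \<tau> (p c)" if c: "c \<in> I" for c
    proof -
      \<comment> \<open>An edge of \<open>c\<close> that is private to some constraint is private to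
        \<open>c\<close> itself, so the other edge of \<open>c\<close> survives the restriction and
        determines \<open>p c\<close>.\<close>
      have other: "e \<in> ?E" if "e \<in> {src h c, tgt h c}" "e \<noteq> p c" for e
      proof -
        have "e \<notin> p ` I" using that priv[OF _ c] by (metis imageE)
        moreover have "e \<in> edges n" using that(1) src_tgt_edges[OF subsetD[OF I(2) c] h] by blast
        ultimately show ?thesis by blast
      qed
      have st: "\<sigma> (src h c) = \<sigma> (tgt h c)" "\<tau> (src h c) = \<tau> (tgt h c)"
        using s t c by auto
      have "p c = src h c \<or> p c = tgt h c" using p[OF c] by blast
      then show ?thesis
      proof
        assume pc: "p c = src h c"
        have "\<sigma> (tgt h c) = \<tau> (tgt h c)" using other p[OF c] pc eqE by (metis insertCI)
        then show ?thesis using st pc by simp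
      next
        assume pc: "p c = tgt h c"
        have "\<sigma> (src h c) = \<tau> (src h c)" using other p[OF c] pc eqE by (metis insertCI)
        then show ?thesis using st pc by simp
      qed
    qed
    have "\<sigma> \<in> edges n \<rightarrow>\<^sub>E {1..q}" "\<tau> \<in> edges n \<rightarrow>\<^sub>E {1..q}"
      using s t by (auto simp: colourings_def)
    then show "\<sigma> = \<tau>"
      by (rule PiE_ext) (use eqE eqp in blast)
  qed
  moreover have "(\<lambda>\<sigma>. restrict \<sigma> ?E) ` ?S \<subseteq> ?E \<rightarrow>\<^sub>E {1..q}"
    by (auto simp: colourings_def)
  moreover have "finite (?E \<rightarrow>\<^sub>E {1..q})" by (intro finite_PiE) auto
  ultimately have "card ?S \<le> card (?E \<rightarrow>\<^sub>E {1..q})" by (rule card_inj_on_le)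
  also have "\<dots> = q ^ (card (edges n) - card I)"
    by (simp add: card_PiE card_Diff_subset pE finI card_image inj)
  finally have "card ?S * q ^ card I \<le> q ^ (card (edges n) - card I) * q ^ card I"
    by (rule mult_right_mono) simp
  also have "\<dots> = q ^ card (edges n)"
  proof -
    have "card I \<le> card (edges n)" using card_mono[OF _ pE] by (simp add: card_image inj)
    then show ?thesis by (simp flip: power_add)
  qed
  finally show ?thesis by (simp add: card_colourings)
qed

section \<open>Union bound over placements\<close>

text \<open>\<open>D\<close> is meant to hold one cell of each cluster and \<open>R\<close> the
  displacements possible inside a cluster.\<close>

definition placements :: "nat \<Rightarrow> vtx \<Rightarrow> vtx set \<Rightarrow> vtx set \<Rightarrow> vtx set \<Rightarrow> (vtx \<Rightarrow> vtx) set" where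
  "placements n v X D R =
    {h \<in> X \<rightarrow>\<^sub>E grid n. h 0 = v \<and> (\<forall>x\<in>X. \<exists>d\<in>D. h x - h d \<in> R)}"

text \<open>As \<open>h 0 = v\<close>, only \<open>card D - 1\<close> cells are placed freely, each
  in at most n^2 ways; every cell of \<open>X\<close> then needs just the choice of a cell of
  \<open>D\<close> and of a displacement in \<open>R\<close>.\<close>

lemma card_placements:
  assumes "finite X" "D \<subseteq> X" "0 \<in> D" "finite R"
  shows "card (placements n v X D R) \<le> n ^ (2 * (card D - 1)) * (card D * card R) ^ card X"
proof -
  have finD: "finite D" by (rule finite_subset[OF assms(2,1)])
  define \<delta> where "\<delta> h x = (SOME d. d \<in> D \<and> h x - h d \<in> R)" for h :: "vtx \<Rightarrow> vtx" and x
  have \<delta>: "\<delta> h x \<in> D \<and> h x - h (\<delta> h x) \<in> R" if "h \<in> placements n v X D R" "x \<in> X" for h x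
  proof -
    have "\<exists>d. d \<in> D \<and> h x - h d \<in> R" using that unfolding placements_def by blast
    then show ?thesis unfolding \<delta>_def by (rule someI_ex)
  qed
  define \<Phi> where "\<Phi> h = (restrict h (D - {0}), \<lambda>x\<in>X. (\<delta> h x, h x - h (\<delta> h x)))" for h
  let ?T = "((D - {0}) \<rightarrow>\<^sub>E grid n) \<times> (X \<rightarrow>\<^sub>E (D \<times> R))"
  have "inj_on \<Phi> (placements n v X D R)"
  proof (rule inj_onI)
    fix g h assume g: "g \<in> placements n v X D R" and h: "h \<in> placements n v X D R"
      and eq: "\<Phi> g = \<Phi> h"
    have "restrict g (D - {0}) = restrict h (D - {0})" using eq by (simp add: \<Phi>_def)
    then have "g d = h d" if "d \<in> D - {0}" for d using that by (metis restrict_apply')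
    moreover have "g 0 = h 0" using g h by (simp add: placements_def)
    ultimately have D: "g d = h d" if "d \<in> D" for d using that by (cases "d = 0") auto
    have "g x = h x" if x: "x \<in> X" for x
    proof -
      have "(\<lambda>x\<in>X. (\<delta> g x, g x - g (\<delta> g x))) = (\<lambda>x\<in>X. (\<delta> h x, h x - h (\<delta> h x)))"
        using eq by (simp add: \<Phi>_def)
      from fun_cong[OF this, of x] x have "\<delta> g x = \<delta> h x" "g x - g (\<delta> g x) = h x - h (\<delta> h x)"
        by auto
      then show ?thesis using D[of "\<delta> g x"] \<delta>[OF g x] by simp
    qed
    moreover have "g \<in> X \<rightarrow>\<^sub>E grid n" "h \<in> X \<rightarrow>\<^sub>E grid n"
      using g h by (auto simp: placements_def)
    ultimately show "g = h" by (metis PiE_ext)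
  qed
  moreover have "\<Phi> h \<in> ?T" if h: "h \<in> placements n v X D R" for h
  proof -
    have "restrict h (D - {0}) \<in> (D - {0}) \<rightarrow>\<^sub>E grid n"
      using h \<open>D \<subseteq> X\<close> by (auto simp: placements_def)
    moreover have "(\<lambda>x\<in>X. (\<delta> h x, h x - h (\<delta> h x))) \<in> X \<rightarrow>\<^sub>E (D \<times> R)"
      by (rule restrict_PiE_iff[THEN iffD2]) (use \<delta>[OF h] in blast)
    ultimately show ?thesis by (simp add: \<Phi>_def)
  qed
  then have "\<Phi> ` placements n v X D R \<subseteq> ?T" by blast
  moreover have "finite ?T"
    by (intro finite_cartesian_product finite_PiE) (use finD assms in auto)
  ultimately have "card (placements n v X D R) \<le> card ?T" by (intro card_inj_on_le[of \<Phi>])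
  also have "\<dots> = n ^ (2 * (card D - 1)) * (card D * card R) ^ card X"
    using finD assms by (simp add: card_cartesian_product card_PiE card_grid power_mult)
  finally show ?thesis .
qed


text \<open>The witness that \<open>f\<close> is unlikely: placing \<open>X\<close> costs
  \<open>2 * (card D - 1)\<close> factors \<open>n\<close>, and the constraints gain
  \<open>card I\<close> factors \<open>q\<close>. The number of possible triples
  \<open>(X, D, I)\<close> depends on \<open>k\<close> alone.\<close>

definition certificate ::
  "nat \<Rightarrow> vtx set \<Rightarrow> (vtx \<Rightarrow> vtx) \<Rightarrow> vtx set \<Rightarrow> vtx set \<Rightarrow> (bool \<times> vtx) set \<Rightarrow> bool" where
  "certificate k R f X D I \<longleftrightarrow> X \<subseteq> box k \<and> D \<subseteq> X \<and> 0 \<in> D \<and> I \<subseteq> links X \<and> indep f I \<and>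
    (\<forall>x\<in>X. \<exists>d\<in>D. f x - f d \<in> R)"

lemma src_tgt_restrict:
  assumes "c \<in> links X"
  shows "src (restrict f X) c = src f c" "tgt (restrict f X) c = tgt f c"
  using assms by (auto simp: links_def src_def tgt_def)

lemma indep_restrict:
  assumes "indep f I" "I \<subseteq> links X"
  shows "indep (restrict f X) I"
proof -
  have "src (restrict f X) c = src f c" "tgt (restrict f X) c = tgt f c" if "c \<in> I" for c
    using src_tgt_restrict assms(2) that by blast+
  then show ?thesis using assms(1) unfolding indep_def by (metis (no_types, lifting))
qed

text \<open>Union bound over the triples, then over the placements of \<open>X\<close>. A triple
  contributes at most a constant times \<open>n ^ (2 * (card D - 1)) / q ^ card I\<close>, hence at
  most that constant times \<open>\<beta>\<close>.\<close>

lemma puzzle_prob_le: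
  fixes \<beta> :: real
  assumes R: "finite R" "R \<noteq> {}" and q: "q \<ge> 1" and \<beta>: "\<beta> \<ge> 0"
    and cert: "\<And>\<sigma> f. f \<in> Sk n k \<sigma> v \<Longrightarrow> P f \<Longrightarrow>
      \<exists>X D I. certificate k R f X D I \<and> real n ^ (2 * (card D - 1)) \<le> \<beta> * real q ^ card I"
  shows "puzzle_prob n q (\<lambda>\<sigma>. \<exists>f\<in>Sk n k \<sigma> v. P f) \<le>
    real (card (Pow (box k) \<times> Pow (box k) \<times> Pow (links (box k)))) *
    real ((card (box k) * card R) ^ card (box k)) * \<beta>"
proof -
  define E where "E = {\<sigma> \<in> colourings n q. \<exists>f\<in>Sk n k \<sigma> v. P f}"
  define T where "T = Pow (box k) \<times> Pow (box k) \<times> Pow (links (box k))"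
  define T' where "T' = {(X, D, I) \<in> T. D \<subseteq> X \<and> 0 \<in> D \<and> I \<subseteq> links X \<and>
    real n ^ (2 * (card D - 1)) \<le> \<beta> * real q ^ card I}"
  define H where "H t = (case t of (X, D, I) \<Rightarrow> {h \<in> placements n v X D R. indep h I})" for t
  define S where "S t h = (case t of (X, D, I) \<Rightarrow>
    {\<sigma> \<in> colourings n q. \<forall>c\<in>I. \<sigma> (src h c) = \<sigma> (tgt h c)})"
    for t :: "vtx set \<times> vtx set \<times> (bool \<times> vtx) set" and h
  define K where "K = (card (box k) * card R) ^ card (box k)"
  define N where "N = real (card (colourings n q))"
  have "colourings n q \<noteq> {}" "finite (colourings n q)"
    using q by (auto simp: colourings_def PiE_eq_empty_iff intro: finite_PiE)
  then have N: "N > 0" and fincol: "finite (colourings n q)" by (auto simp: N_def card_gt_0_iff)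
  have finT: "finite T" unfolding T_def by (intro finite_cartesian_product) (auto intro: finite_links)
  have T'T: "T' \<subseteq> T" by (auto simp: T'_def)
  then have finT': "finite T'" using finT by (rule finite_subset)
  have finH: "finite (H t)" if "t \<in> T'" for t
  proof -
    obtain X D I where t: "t = (X, D, I)" by (cases t)
    have "finite X" using that finite_subset[OF _ finite_box] by (auto simp: t T'_def T_def)
    then have "finite (X \<rightarrow>\<^sub>E grid n)" by (intro finite_PiE) auto
    then show ?thesis by (rule rev_finite_subset) (auto simp: H_def t placements_def)
  qed
  have finS: "finite (S t h)" for t h
    using fincol by (auto simp: S_def split: prod.splits intro: rev_finite_subset)
  have sub: "E \<subseteq> (\<Union>t\<in>T'. \<Union>h\<in>H t. S t h)"
  proof
    fix \<sigma> assume "\<sigma> \<in> E"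
    then obtain f where \<sigma>: "\<sigma> \<in> colourings n q" and f: "f \<in> Sk n k \<sigma> v" "P f"
      by (auto simp: E_def)
    from cert[OF f] obtain X D I where c: "certificate k R f X D I"
      and w: "real n ^ (2 * (card D - 1)) \<le> \<beta> * real q ^ card I" by blast
    \<comment> \<open>The values of \<open>f\<close> outside \<open>X\<close> are forgotten, so they
      do not have to be placed.\<close>
    let ?h = "restrict f X"
    have Xk: "X \<subseteq> box k" and I: "I \<subseteq> links X" "I \<subseteq> links (box k)" and D: "D \<subseteq> X" "0 \<in> D"
      using c links_mono[of X "box k"] by (auto simp: certificate_def)
    have "(X, D, I) \<in> T'" using Xk I D w by (auto simp: T'_def T_def)
    moreover have "?h \<in> H (X, D, I)"
    proof -
      have "f 0 = v" "f \<in> box k \<rightarrow>\<^sub>E grid n" using f(1) by (auto simp: Sk_def zero_prod_def)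
      moreover have "0 \<in> X" using D by blast
      moreover have "?h x - ?h d = f x - f d" if "x \<in> X" "d \<in> D" for x d using that D by auto
      moreover have "?h \<in> X \<rightarrow>\<^sub>E grid n"
        using \<open>f \<in> box k \<rightarrow>\<^sub>E grid n\<close> Xk by (auto dest: PiE_mem)
      ultimately have "?h \<in> placements n v X D R"
        using c by (simp add: placements_def certificate_def)
      moreover have "indep ?h I"
        using c indep_restrict I(1) by (simp add: certificate_def)
      ultimately show ?thesis by (simp add: H_def)
    qed
    moreover have "\<sigma> \<in> S (X, D, I) ?h"
    proof -
      have "\<sigma> (src ?h c) = \<sigma> (tgt ?h c)" if "c \<in> I" for c
      proof -
        have "feasible k \<sigma> f" using f(1) by (simp add: Sk_def)
        then have "\<sigma> (src f c) = \<sigma> (tgt f c)" using feasible_links I(2) that by blast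
        then show ?thesis using src_tgt_restrict subsetD[OF I(1) that] by simp
      qed
      then show ?thesis using \<sigma> by (simp add: S_def)
    qed
    ultimately show "\<sigma> \<in> (\<Union>t\<in>T'. \<Union>h\<in>H t. S t h)" by blast
  qed
  have each: "real (card (\<Union>h\<in>H t. S t h)) \<le> real K * \<beta> * N" if t': "t \<in> T'" for t
  proof -
    obtain X D I where t: "t = (X, D, I)" by (cases t)
    have Xk: "X \<subseteq> box k" and I: "I \<subseteq> links X" and D: "D \<subseteq> X" "0 \<in> D"
      and w: "real n ^ (2 * (card D - 1)) \<le> \<beta> * real q ^ card I"
      using t' by (auto simp: T'_def T_def t)
    have finX: "finite X" by (rule finite_subset[OF Xk finite_box])
    have Sle: "real (card (S t h)) \<le> N / real q ^ card I" if h: "h \<in> H t" for h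
    proof -
      have "indep h I" "h ` X \<subseteq> grid n" using h by (auto simp: H_def t placements_def)
      from card_indep_colourings[OF this(1) I finX this(2), of q]
      have "real (card (S t h) * q ^ card I) \<le> N" unfolding S_def t N_def by (simp del: of_nat_mult)
      then show ?thesis using q by (simp add: field_simps)
    qed
    have "card (\<Union>h\<in>H t. S t h) \<le> (\<Sum>h\<in>H t. card (S t h))"
      by (rule card_UN_le[OF finH[OF t']])
    then have "real (card (\<Union>h\<in>H t. S t h)) \<le> (\<Sum>h\<in>H t. real (card (S t h)))"
      by (simp only: of_nat_le_iff flip: of_nat_sum)
    also have "\<dots> \<le> real (card (H t)) * (N / real q ^ card I)"
      by (rule sum_bounded_above) (rule Sle)
    also have "\<dots> \<le> real (n ^ (2 * (card D - 1)) * K) * (N / real q ^ card I)"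
    proof -
      have finP: "finite (placements n v X D R)"
        by (rule finite_subset[of _ "X \<rightarrow>\<^sub>E grid n"])
          (auto simp: placements_def intro: finite_PiE finX)
      have cd: "card D \<le> card (box k)" "card X \<le> card (box k)"
        using D Xk by (auto intro!: card_mono)
      have "0 < card R" using R by (simp add: card_gt_0_iff)
      moreover have "0 < card (box k)" by (simp add: card_box)
      ultimately have pos: "1 \<le> card (box k) * card R" by simp
      have "card (H t) \<le> card (placements n v X D R)"
        by (rule card_mono[OF finP]) (auto simp: H_def t)
      also have "\<dots> \<le> n ^ (2 * (card D - 1)) * (card D * card R) ^ card X"
        by (rule card_placements[OF finX D R(1)])
      \<comment> \<open>Base and exponent are enlarged so that the factor no longer depends on the
        triple.\<close>
      also have "(card D * card R) ^ card X \<le> (card (box k) * card R) ^ card X"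
        by (intro power_mono mult_right_mono cd) auto
      also have "\<dots> \<le> K" unfolding K_def by (rule power_increasing[OF cd(2) pos])
      finally have "card (H t) \<le> n ^ (2 * (card D - 1)) * K" by simp
      then have "real (card (H t)) \<le> real (n ^ (2 * (card D - 1)) * K)" by (simp only: of_nat_le_iff)
      then show ?thesis by (rule mult_right_mono) (use N in simp)
    qed
    also have "\<dots> = real n ^ (2 * (card D - 1)) * (real K * N / real q ^ card I)" by simp
    also have "\<dots> \<le> (\<beta> * real q ^ card I) * (real K * N / real q ^ card I)"
      by (rule mult_right_mono[OF w]) (use N in simp)
    also have "\<dots> = real K * \<beta> * N" using q by simp
    finally show ?thesis .
  qed
  have "card E \<le> card (\<Union>t\<in>T'. \<Union>h\<in>H t. S t h)"
    by (rule card_mono[OF _ sub]) (use finT' finH finS in auto)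
  also have "\<dots> \<le> (\<Sum>t\<in>T'. card (\<Union>h\<in>H t. S t h))"
    by (rule card_UN_le[OF finT'])
  finally have "real (card E) \<le> (\<Sum>t\<in>T'. real (card (\<Union>h\<in>H t. S t h)))"
    by (simp only: of_nat_le_iff flip: of_nat_sum)
  also have "\<dots> \<le> real (card T') * (real K * \<beta> * N)"
    by (rule sum_bounded_above) (rule each)
  also have "\<dots> \<le> real (card T) * (real K * \<beta> * N)"
    by (rule mult_right_mono) (use \<beta> N card_mono[OF finT T'T] in simp_all)
  finally have "real (card E) / N \<le> real (card T) * real K * \<beta>"
    using N by (simp add: field_simps)
  then show ?thesis unfolding puzzle_prob_def E_def N_def T_def K_def .
qed

section \<open>Adjacencies of lattice sets\<close>

definition adjacencies :: "bool \<Rightarrow> vtx set \<Rightarrow> nat" where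
  "adjacencies d S = card {y \<in> S. y + stp d \<in> S}"

text \<open>The last cell of each line in direction \<open>stp d\<close> has no successor in
  \<open>S\<close>; the lines are indexed by the other coordinate.\<close>

lemma adjacencies_le_rows:
  assumes "finite S"
  shows "adjacencies d S + card ((if d then snd else fst) ` S) \<le> card S"
proof -
  let ?\<pi> = "if d then snd else fst :: vtx \<Rightarrow> int" and ?\<rho> = "if d then fst else snd :: vtx \<Rightarrow> int"
  let ?L = "{y \<in> S. y + stp d \<notin> S}"
  have "?\<pi> ` S \<subseteq> ?\<pi> ` ?L"
  proof
    fix r assume "r \<in> ?\<pi> ` S"
    then have ne: "{y \<in> S. ?\<pi> y = r} \<noteq> {}" by blast
    have fin: "finite {y \<in> S. ?\<pi> y = r}" using assms by simp
    obtain y where y: "y \<in> S" "?\<pi> y = r" and max: "\<And>z. z \<in> S \<Longrightarrow> ?\<pi> z = r \<Longrightarrow> ?\<rho> z \<le> ?\<rho> y"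
    proof -
      have "Max (?\<rho> ` {y \<in> S. ?\<pi> y = r}) \<in> ?\<rho> ` {y \<in> S. ?\<pi> y = r}"
        using fin ne by (intro Max_in) auto
      then obtain y where "y \<in> {y \<in> S. ?\<pi> y = r}" "?\<rho> y = Max (?\<rho> ` {y \<in> S. ?\<pi> y = r})" by auto
      then show ?thesis using fin by (intro that[of y]) auto
    qed
    have "?\<pi> (y + stp d) = r" "?\<rho> (y + stp d) = ?\<rho> y + 1"
      using y by (auto simp: stp_def)
    then have "y + stp d \<notin> S" using max[of "y + stp d"] by auto
    then show "r \<in> ?\<pi> ` ?L" using y by blast
  qed
  then have "card (?\<pi> ` S) \<le> card ?L"
    using assms by (intro surj_card_le) auto
  moreover have "card S = adjacencies d S + card ?L"
    unfolding adjacencies_def using assms by (subst card_Un_disjoint[symmetric]) (auto intro: arg_cong[of _ _ card])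
  ultimately show ?thesis by simp
qed

text \<open>\<open>S\<close> lies in the product of its two projections, so the sum of their sizes,
  which the row bounds save, is at least \<open>2 * sqrt (card S)\<close> by the inequality of
  arithmetic and geometric means.\<close>

lemma adjacencies_le_sqrt:
  assumes "finite S"
  shows "real (adjacencies True S) + real (adjacencies False S) \<le> 2 * real (card S) - 2 * sqrt (real (card S))"
proof -
  let ?a = "real (card (fst ` S))" and ?b = "real (card (snd ` S))"
  have "card S \<le> card (fst ` S \<times> snd ` S)"
    using assms by (intro card_mono subsetI) (auto simp only: finite_cartesian_product finite_imageI mem_Times_iff imageI)
  then have "real (card S) \<le> ?a * ?b"
    by (simp add: card_cartesian_product flip: of_nat_mult)
  then have "sqrt (real (card S)) \<le> sqrt (?a * ?b)" by simp
  also have "\<dots> \<le> (?a + ?b) / 2" by (rule arith_geo_mean_sqrt) auto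
  finally have "2 * sqrt (real (card S)) \<le> ?a + ?b" by simp
  moreover have "real (adjacencies True S) + ?b \<le> real (card S)" "real (adjacencies False S) + ?a \<le> real (card S)"
    using adjacencies_le_rows[OF assms, of True] adjacencies_le_rows[OF assms, of False] by simp_all
  ultimately show ?thesis by linarith
qed

text \<open>Steps are counted rather than cells: a corner of a box of positive radius contributes
  two.\<close>

definition exits :: "vtx set \<Rightarrow> vtx set \<Rightarrow> nat" where
  "exits X A = (\<Sum>d\<in>UNIV. card {x \<in> A. x + stp d \<notin> X} + card {x \<in> A. x - stp d \<notin> X})"

text \<open>Double counting of the \<open>4 * card A\<close> pairs of a cell of \<open>A\<close> and
  a direction: each leaves \<open>X\<close> or follows a link meeting \<open>A\<close>, and the
  links with both ends in \<open>A\<close> occur twice.\<close>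

lemma card_links_meeting:
  assumes fin: "finite X" and A: "A \<subseteq> X"
  shows "card {(d, x). (d, x) \<in> links X \<and> (x \<in> A \<or> x + stp d \<in> A)} + adjacencies True A + adjacencies False A + exits X A
    = 4 * card A"
proof -
  have finA: "finite A" by (rule finite_subset[OF A fin])
  let ?T = "\<lambda>d. {x \<in> X. x + stp d \<in> X \<and> (x \<in> A \<or> x + stp d \<in> A)}"
  have T: "card (?T d) + adjacencies d A + (card {x \<in> A. x + stp d \<notin> X} + card {x \<in> A. x - stp d \<notin> X})
      = 2 * card A" for d
  proof -
    have "?T d = {x \<in> A. x + stp d \<in> X} \<union> {x \<in> X. x + stp d \<in> A}" using A by blast
    moreover have "{x \<in> A. x + stp d \<in> X} \<inter> {x \<in> X. x + stp d \<in> A} = {y \<in> A. y + stp d \<in> A}"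
      using A by blast
    ultimately have "card (?T d) + adjacencies d A = card {x \<in> A. x + stp d \<in> X} + card {x \<in> X. x + stp d \<in> A}"
      unfolding adjacencies_def using card_Un_Int[of "{x \<in> A. x + stp d \<in> X}" "{x \<in> X. x + stp d \<in> A}"] fin finA
      by simp
    moreover have "card {x \<in> X. x + stp d \<in> A} = card {y \<in> A. y - stp d \<in> X}"
      by (rule bij_betw_same_card[of "\<lambda>x. x + stp d"])
        (rule bij_betwI[where g = "\<lambda>y. y - stp d"], auto)
    moreover have "card {x \<in> A. P x} + card {x \<in> A. \<not> P x} = card A" for P
      using finA by (subst card_Un_disjoint[symmetric]) (auto intro: arg_cong[of _ _ card])
    from this[of "\<lambda>x. x + stp d \<in> X"] this[of "\<lambda>x. x - stp d \<in> X"]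
    have "card {x \<in> A. x + stp d \<in> X} + card {x \<in> A. x + stp d \<notin> X} = card A"
      "card {x \<in> A. x - stp d \<in> X} + card {x \<in> A. x - stp d \<notin> X} = card A" by auto
    ultimately show ?thesis by simp
  qed
  have "{(d, x). (d, x) \<in> links X \<and> (x \<in> A \<or> x + stp d \<in> A)} = (SIGMA d:UNIV. ?T d)"
    by (auto simp: links_def)
  then have "card {(d, x). (d, x) \<in> links X \<and> (x \<in> A \<or> x + stp d \<in> A)} = (\<Sum>d\<in>UNIV. card (?T d))"
    using fin by (simp only: card_SigmaI finite_UNIV) simp
  then show ?thesis using T[of True] T[of False] by (simp add: UNIV_bool exits_def)
qed

text \<open>
  Of the links meeting \<open>A\<close>, drop those whose target edge joins two cells of \<open>f ` A\<close>; their number is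
  bounded by the adjacencies inside the clusters. For a remaining link the target edge is private
  if its endpoint lies in \<open>A\<close>, and the source edge otherwise.
\<close>

lemma exists_indep:
  fixes \<kappa> :: "vtx \<Rightarrow> 'a"
  assumes fin: "finite X" and A: "A \<subseteq> X" and inj: "inj_on f X"
    and adj: "\<And>x y d. x \<in> X \<Longrightarrow> y \<in> X \<Longrightarrow> f y = f x + stp d \<Longrightarrow> \<kappa> x = \<kappa> y"
    and closed: "\<And>x y. x \<in> A \<Longrightarrow> y \<in> X \<Longrightarrow> \<kappa> x = \<kappa> y \<Longrightarrow> y \<in> A"
  shows "\<exists>I\<subseteq>links X. indep f I \<and>
    real (card I) \<ge> 2 * sqrt (real (card A)) - real (exits X A)
      + 2 * (\<Sum>i\<in>\<kappa> ` A. sqrt (real (card {x \<in> A. \<kappa> x = i})))"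
proof -
  have finA: "finite A" by (rule finite_subset[OF A fin])
  define inner where "inner d x \<longleftrightarrow> x + stp d \<in> A \<and> f (x + stp d) - stp d \<in> f ` A" for d x
  define T where "T = {(d, x). (d, x) \<in> links X \<and> (x \<in> A \<or> x + stp d \<in> A)}"
  define Rm where "Rm = {(d, x). (d, x) \<in> links X \<and> inner d x}"
  define I where "I = T - Rm"
  have IX: "I \<subseteq> links X" by (auto simp: I_def T_def)
  \<comment> \<open>Adjacent images put two cells into one cluster, and \<open>A\<close> is a union
    of clusters.\<close>
  have adjA: "x \<in> A \<longleftrightarrow> y \<in> A" if "x \<in> X" "y \<in> X" "f x = f y - stp d" for x y d
    using adj[of x y d] that closed[of x y] closed[of y x] by auto
  define p where "p c = (if snd c + stp (fst c) \<in> A then tgt f c else src f c)" for c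
  have "indep f I" unfolding indep_def
  proof (intro exI[of _ p] ballI conjI impI)
    fix c assume c: "c \<in> I"
    obtain d x where cx: "c = (d, x)" by (cases c)
    have x: "x \<in> X" "x + stp d \<in> X" "x \<in> A \<or> x + stp d \<in> A" "\<not> inner d x"
      using c by (auto simp: cx I_def T_def Rm_def links_def)
    show "src f c \<noteq> tgt f c"
    proof
      assume "src f c = tgt f c"
      then have eq: "f x = f (x + stp d) - stp d" by (simp add: cx src_def tgt_def)
      then have "x \<in> A" "x + stp d \<in> A" using adjA[OF x(1,2) eq] x(3) by auto
      then have "inner d x" unfolding inner_def using eq by (metis imageI)
      then show False using x by simp
    qed
    show "p c \<in> {src f c, tgt f c}" by (simp add: p_def)
    fix c' assume c': "c' \<in> I" and ne: "c' \<noteq> c"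
    obtain d' x' where cx': "c' = (d', x')" by (cases c')
    have x': "x' \<in> X" "x' + stp d' \<in> X" "x' \<in> A \<or> x' + stp d' \<in> A" "\<not> inner d' x'"
      using c' by (auto simp: cx' I_def T_def Rm_def links_def)
    show "p c \<notin> {src f c', tgt f c'}"
    proof (cases "x + stp d \<in> A")
      case True
      have "tgt f c \<noteq> tgt f c'"
      proof
        assume "tgt f c = tgt f c'"
        then have "d = d'" "f (x + stp d) = f (x' + stp d)" by (auto simp: cx cx' tgt_def)
        then show False using inj_onD[OF inj] x(2) x'(2) ne cx cx' by fastforce
      qed
      \<comment> \<open>Equality would make the target edge of \<open>c\<close> join two images of
        cells of \<open>A\<close>, so \<open>c\<close> would have been dropped.\<close>
      moreover have "tgt f c \<noteq> src f c'"
      proof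
        assume "tgt f c = src f c'"
        then have "d = d'" and eq: "f x' = f (x + stp d) - stp d" by (auto simp: cx cx' tgt_def src_def)
        then have "x' \<in> A" using adjA[OF x'(1) x(2) eq] True by simp
        then have "inner d x" unfolding inner_def using True eq by (metis imageI)
        then show False using x by simp
      qed
      ultimately show ?thesis using True by (simp add: p_def cx)
    next
      case False
      then have "x \<in> A" using x by blast
      have "src f c \<noteq> src f c'"
      proof
        assume "src f c = src f c'"
        then have "d = d'" "f x = f x'" by (auto simp: cx cx' src_def)
        then show False using inj_onD[OF inj] x(1) x'(1) ne cx cx' by fastforce
      qed
      \<comment> \<open>Here \<open>x \<in> A\<close> would pull the far end of \<open>c'\<close>
        into \<open>A\<close>, so \<open>c'\<close> would have been dropped.\<close>
      moreover have "src f c \<noteq> tgt f c'"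
      proof
        assume "src f c = tgt f c'"
        then have "d = d'" and eq: "f x = f (x' + stp d') - stp d'" by (auto simp: cx cx' tgt_def src_def)
        then have "x' + stp d' \<in> A" using adjA[OF x(1) x'(2) eq] \<open>x \<in> A\<close> by simp
        then have "inner d' x'" unfolding inner_def using \<open>x \<in> A\<close> eq by (metis imageI)
        then show False using x' by simp
      qed
      ultimately show ?thesis using False by (simp add: p_def cx)
    qed
  qed
  define cl where "cl i = {x \<in> A. \<kappa> x = i}" for i
  have fincl: "finite (cl i)" for i using finA by (simp add: cl_def)
  have inj_cl: "inj_on f (cl i)" for i
    by (rule inj_on_subset[OF inj]) (use A in \<open>auto simp: cl_def\<close>)
  have fib: "(\<Sum>i\<in>\<kappa> ` A. card {x \<in> cl i. P x}) = card {x \<in> A. P x}" for P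
  proof -
    have "{x \<in> {x \<in> A. P x}. \<kappa> x = i} = {x \<in> cl i. P x}" for i by (auto simp: cl_def)
    then show ?thesis
      using sum.group[of "{x \<in> A. P x}" "\<kappa> ` A" \<kappa> "\<lambda>_. 1 :: nat"] finA by (simp add: image_mono)
  qed
  \<comment> \<open>An adjacency of images never joins two clusters, so adjacencies can be counted
    cluster by cluster.\<close>
  have in_le: "card {y \<in> cl i. f y - stp d \<in> f ` A} \<le> adjacencies d (f ` cl i)" for d i
    unfolding adjacencies_def
  proof (rule card_inj_on_le[where f = "\<lambda>y. f y - stp d"])
    show "inj_on (\<lambda>y. f y - stp d) {y \<in> cl i. f y - stp d \<in> f ` A}"
      using inj_cl[of i] by (auto simp: inj_on_def)
    show "(\<lambda>y. f y - stp d) ` {y \<in> cl i. f y - stp d \<in> f ` A} \<subseteq> {y \<in> f ` cl i. y + stp d \<in> f ` cl i}"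
    proof
      fix w assume "w \<in> (\<lambda>y. f y - stp d) ` {y \<in> cl i. f y - stp d \<in> f ` A}"
      then obtain y z where y: "y \<in> cl i" and z: "z \<in> A" and eq: "f y - stp d = f z"
        and w: "w = f z" by auto
      have fy: "f y = f z + stp d" using eq by (metis diff_add_cancel)
      have "\<kappa> z = \<kappa> y" by (rule adj[OF _ _ fy]) (use y z A in \<open>auto simp: cl_def\<close>)
      then have "z \<in> cl i" using y z by (simp add: cl_def)
      moreover have "f z + stp d = f y" using fy by simp
      ultimately show "w \<in> {y \<in> f ` cl i. y + stp d \<in> f ` cl i}" using y w by simp
    qed
    show "finite {y \<in> f ` cl i. y + stp d \<in> f ` cl i}" using fincl by simp
  qed
  have Rm: "card Rm \<le> (\<Sum>d\<in>UNIV. \<Sum>i\<in>\<kappa> ` A. adjacencies d (f ` cl i))"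
  proof -
    have "card Rm \<le> card (SIGMA d:UNIV. {y \<in> A. f y - stp d \<in> f ` A})"
      by (rule card_inj_on_le[where f = "\<lambda>c. (fst c, snd c + stp (fst c))"])
        (auto simp: Rm_def inner_def inj_on_def finA)
    also have "\<dots> = (\<Sum>d\<in>UNIV. card {y \<in> A. f y - stp d \<in> f ` A})"
      using finA by (intro card_SigmaI) auto
    also have "\<dots> = (\<Sum>d\<in>UNIV. \<Sum>i\<in>\<kappa> ` A. card {y \<in> cl i. f y - stp d \<in> f ` A})"
      by (simp only: fib)
    also have "\<dots> \<le> (\<Sum>d\<in>UNIV. \<Sum>i\<in>\<kappa> ` A. adjacencies d (f ` cl i))"
      by (intro sum_mono in_le)
    finally show ?thesis .
  qed
  have "real (card Rm) \<le> (\<Sum>i\<in>\<kappa> ` A. real (adjacencies True (f ` cl i)) + real (adjacencies False (f ` cl i)))"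
  proof -
    have "real (card Rm) \<le> real (\<Sum>d\<in>UNIV. \<Sum>i\<in>\<kappa> ` A. adjacencies d (f ` cl i))"
      using Rm by (simp only: of_nat_le_iff)
    then show ?thesis by (simp add: UNIV_bool sum.distrib add.commute)
  qed
  also have "\<dots> \<le> (\<Sum>i\<in>\<kappa> ` A. 2 * real (card (cl i)) - 2 * sqrt (real (card (cl i))))"
  proof (rule sum_mono)
    fix i
    show "real (adjacencies True (f ` cl i)) + real (adjacencies False (f ` cl i))
        \<le> 2 * real (card (cl i)) - 2 * sqrt (real (card (cl i)))"
      using adjacencies_le_sqrt[of "f ` cl i"] fincl by (simp add: card_image inj_cl)
  qed
  also have "\<dots> = 2 * real (card A) - 2 * (\<Sum>i\<in>\<kappa> ` A. sqrt (real (card (cl i))))"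
    using fib[of "\<lambda>_. True"] by (simp add: sum_subtractf sum_distrib_left[symmetric] flip: of_nat_sum)
  finally have "real (card Rm) \<le> \<dots>" .
  moreover have "card T \<le> card I + card Rm"
  proof -
    have "finite T" "finite Rm" using finite_links[OF fin]
      by (auto intro!: finite_subset[of _ "links X"] simp: T_def Rm_def)
    then show ?thesis unfolding I_def using diff_card_le_card_Diff[of Rm T] by simp
  qed
  moreover have "real (card T) + real (adjacencies True A) + real (adjacencies False A) + real (exits X A) = 4 * real (card A)"
    using card_links_meeting[OF fin A] unfolding T_def by linarith
  moreover have "real (adjacencies True A) + real (adjacencies False A) \<le> 2 * real (card A) - 2 * sqrt (real (card A))"
    by (rule adjacencies_le_sqrt[OF finA])
  \<comment> \<open>At least \<open>2 * card A + 2 * sqrt (card A) - exits X A\<close> links meet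
    \<open>A\<close>, and at most \<open>2 * card A\<close> minus twice the sum of roots are
    dropped; the linear terms cancel.\<close>
  ultimately have "real (card I) \<ge> 2 * sqrt (real (card A)) - real (exits X A)
      + 2 * (\<Sum>i\<in>\<kappa> ` A. sqrt (real (card (cl i))))" by linarith
  then show ?thesis using IX \<open>indep f I\<close> unfolding cl_def by blast
qed

section \<open>Clusters\<close>

definition window :: "nat \<Rightarrow> vtx set" where
  "window M = {- int M..int M} \<times> {- int M..int M}"

lemma window_mono: "M \<le> N \<Longrightarrow> window M \<subseteq> window N"
  by (auto simp: window_def)

text \<open>\<open>\<kappa> x\<close> is the component of \<open>x\<close> under adjacency of
  images. Two cells of a component are joined by a path of at most \<open>card E\<close> steps, each
  moving the image by one unit. Cells outside \<open>B\<close> form singleton components.\<close>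

lemma exists_clusters:
  assumes "finite B"
  shows "\<exists>\<kappa> :: vtx \<Rightarrow> vtx set. (\<forall>x\<in>B. \<forall>y\<in>B. \<forall>d. f y = f x + stp d \<longrightarrow> \<kappa> x = \<kappa> y) \<and>
    (\<forall>x y. \<kappa> x = \<kappa> y \<longrightarrow> f x - f y \<in> window ((card B)\<^sup>2))"
proof -
  define E where "E = {(x, y). x \<in> B \<and> y \<in> B \<and> (\<exists>d. f y = f x + stp d \<or> f x = f y + stp d)}"
  define \<kappa> where "\<kappa> x = E\<^sup>* `` {x}" for x
  have EB: "E \<subseteq> B \<times> B" by (auto simp: E_def)
  then have finE: "finite E" using assms by (meson finite_SigmaI finite_subset)
  have "card E \<le> card (B \<times> B)" using EB assms by (intro card_mono) auto
  then have cardE: "card E \<le> (card B)\<^sup>2" by (simp add: card_cartesian_product power2_eq_square)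
  have "sym E" by (auto simp: E_def sym_def)
  then have symE: "sym (E\<^sup>*)" by (rule sym_rtrancl)
  have step: "f x - f y \<in> window N" if "(x, y) \<in> E ^^ N" for N x y
    using that
  proof (induction N arbitrary: y)
    case 0
    then show ?case by (simp add: window_def zero_prod_def)
  next
    case (Suc N)
    then obtain z where z: "(x, z) \<in> E ^^ N" "(z, y) \<in> E" by auto
    from z(2) have "\<exists>d. f z - f y = stp d \<or> f z - f y = - stp d"
      by (auto simp: E_def)
    then have "f z - f y \<in> window 1"
      by (auto simp: window_def stp_def)
    moreover have "f x - f z \<in> window N" using Suc.IH z(1) by blast
    moreover have "f x - f y = (f x - f z) + (f z - f y)" by simp
    ultimately show ?case
      by (auto simp: window_def mem_Times_iff)
  qed
  have "f x - f y \<in> window ((card B)\<^sup>2)" if "\<kappa> x = \<kappa> y" for x y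
  proof -
    have "y \<in> \<kappa> x" unfolding that by (simp add: \<kappa>_def)
    then have "(x, y) \<in> E\<^sup>*" by (simp add: \<kappa>_def)
    then obtain N where N: "N \<le> card E" "(x, y) \<in> E ^^ N"
      unfolding rtrancl_finite_eq_relpow[OF finE] by blast
    have "window N \<subseteq> window ((card B)\<^sup>2)"
      by (rule window_mono) (use N(1) cardE in simp)
    then show ?thesis using step[OF N(2)] by blast
  qed
  moreover have "\<kappa> x = \<kappa> y" if "x \<in> B" "y \<in> B" "f y = f x + stp d" for x y d
  proof -
    have "(x, y) \<in> E" using that by (auto simp: E_def)
    then have xy: "(x, y) \<in> E\<^sup>*" by (rule r_into_rtrancl)
    have yx: "(y, x) \<in> E\<^sup>*" by (rule symD[OF symE xy])
    have "(x, z) \<in> E\<^sup>* \<longleftrightarrow> (y, z) \<in> E\<^sup>*" for z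
      using rtrancl_trans[OF xy] rtrancl_trans[OF yx] by blast
    then show ?thesis by (simp add: \<kappa>_def Image_singleton)
  qed
  ultimately show ?thesis by (intro exI[of _ \<kappa>]) simp
qed

text \<open>Any prescribed cell can represent its own cluster at no cost. This is applied to the
  centre, whose image is known.\<close>

lemma exists_representatives:
  assumes "x0 \<in> X"
  shows "\<exists>D\<subseteq>X. x0 \<in> D \<and> card D = card (\<kappa> ` X) \<and> (\<forall>x\<in>X. \<exists>d\<in>D. \<kappa> x = \<kappa> d)"
proof -
  define r where "r i = (if i = \<kappa> x0 then x0 else inv_into X \<kappa> i)" for i
  have r: "r i \<in> X" "\<kappa> (r i) = i" if "i \<in> \<kappa> ` X" for i
    using that assms by (auto simp: r_def inv_into_into f_inv_into_f)
  have "inj_on r (\<kappa> ` X)" by (metis inj_onI r(2))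
  moreover have "x0 \<in> r ` \<kappa> ` X" using assms by (auto simp: r_def image_iff)
  moreover have "r ` \<kappa> ` X \<subseteq> X" using r by blast
  moreover have "\<forall>x\<in>X. \<exists>d\<in>r ` \<kappa> ` X. \<kappa> x = \<kappa> d" using r(2) by (metis imageI)
  ultimately show ?thesis by (intro exI[of _ "r ` \<kappa> ` X"]) (simp add: card_image)
qed

text \<open>Only the outer ring of the box has exits: one per cell, and a second one at each of the
  four corners.\<close>

lemma exits_box_le:
  assumes "A \<subseteq> box j" "j \<ge> 1"
  shows "exits (box j) A + card (A \<inter> box (j - 1)) \<le> card A + 4"
proof -
  have fin: "finite A" by (rule finite_subset[OF assms(1) finite_box])
  let ?j = "int j"
  let ?H = "{x \<in> A. fst x = ?j \<or> fst x = - ?j}" and ?V = "{x \<in> A. snd x = ?j \<or> snd x = - ?j}"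
  have in_box: "- ?j \<le> fst x \<and> fst x \<le> ?j \<and> - ?j \<le> snd x \<and> snd x \<le> ?j" if "x \<in> A" for x
    using that assms(1) by (auto simp: box_def)
  have "{x \<in> A. x + stp True \<notin> box j} = {x \<in> A. fst x = ?j}"
    "{x \<in> A. x - stp True \<notin> box j} = {x \<in> A. fst x = - ?j}"
    "{x \<in> A. x + stp False \<notin> box j} = {x \<in> A. snd x = ?j}"
    "{x \<in> A. x - stp False \<notin> box j} = {x \<in> A. snd x = - ?j}"
    using in_box by (auto simp: box_def stp_def mem_Times_iff; fastforce)+
  then have "exits (box j) A = card {x \<in> A. fst x = ?j} + card {x \<in> A. fst x = - ?j}
      + (card {x \<in> A. snd x = ?j} + card {x \<in> A. snd x = - ?j})"
    by (simp add: exits_def UNIV_bool)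
  moreover have "card {x \<in> A. fst x = ?j} + card {x \<in> A. fst x = - ?j} = card ?H"
    using fin assms(2) by (subst card_Un_disjoint[symmetric]) (auto intro: arg_cong[of _ _ card])
  moreover have "card {x \<in> A. snd x = ?j} + card {x \<in> A. snd x = - ?j} = card ?V"
    using fin assms(2) by (subst card_Un_disjoint[symmetric]) (auto intro: arg_cong[of _ _ card])
  moreover have "card ?H + card ?V = card (?H \<union> ?V) + card (?H \<inter> ?V)"
    by (rule card_Un_Int) (use fin in auto)
  moreover have "card (?H \<inter> ?V) \<le> 4"
  proof -
    have "card (?H \<inter> ?V) \<le> card {(?j, ?j), (?j, - ?j), (- ?j, ?j), (- ?j, - ?j)}"
      by (rule card_mono) auto
    also have "\<dots> \<le> 4" by (simp add: card_insert_if)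
    finally show ?thesis .
  qed
  moreover have "card (?H \<union> ?V) + card (A \<inter> box (j - 1)) \<le> card A"
  proof -
    have "card (?H \<union> ?V) + card (A \<inter> box (j - 1)) = card ((?H \<union> ?V) \<union> (A \<inter> box (j - 1)))"
      by (rule card_Un_disjoint[symmetric]) (use fin assms(2) in \<open>auto simp: box_def\<close>)
    also have "\<dots> \<le> card A" by (rule card_mono) (use fin in auto)
    finally show ?thesis .
  qed
  ultimately show ?thesis by linarith
qed

lemma exits_box_interior:
  assumes "A \<subseteq> box (j - 1)" "j \<ge> 1"
  shows "exits (box j) A = 0"
proof -
  have in_box: "- int j < fst x \<and> fst x < int j \<and> - int j < snd x \<and> snd x < int j" if "x \<in> A" for x
    using that assms by (auto simp: box_def)
  have "x + stp d \<in> box j" "x - stp d \<in> box j" if "x \<in> A" for x d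
    using in_box[OF that] by (auto simp: box_def stp_def mem_Times_iff)
  then have "{x \<in> A. x + stp d \<notin> box j} = {}" "{x \<in> A. x - stp d \<notin> box j} = {}" for d
    by blast+
  then show ?thesis unfolding exits_def by (simp only: card.empty) simp
qed

lemma exits_full_box: "exits (box k) (box k) \<le> 4 * (2 * k + 1)"
proof -
  let ?J = "{- int k..int k}"
  have "nat (int k + 1 + int k) = 2 * k + 1" by simp
  then have J: "card ?J = 2 * k + 1" by simp
  have strip: "card (if d then {c} \<times> ?J else ?J \<times> {c}) = 2 * k + 1" for d and c :: int
    using J by (simp add: card_cartesian_product)
  have "{x \<in> box k. x + stp d \<notin> box k} \<subseteq> (if d then {int k} \<times> ?J else ?J \<times> {int k})" for d
    by (auto simp: box_def stp_def mem_Times_iff)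
  then have "card {x \<in> box k. x + stp d \<notin> box k} \<le> card (if d then {int k} \<times> ?J else ?J \<times> {int k})" for d
    by (intro card_mono) auto
  then have 1: "card {x \<in> box k. x + stp d \<notin> box k} \<le> 2 * k + 1" for d
    unfolding strip .
  have "{x \<in> box k. x - stp d \<notin> box k} \<subseteq> (if d then {- int k} \<times> ?J else ?J \<times> {- int k})" for d
    by (auto simp: box_def stp_def mem_Times_iff)
  then have "card {x \<in> box k. x - stp d \<notin> box k} \<le> card (if d then {- int k} \<times> ?J else ?J \<times> {- int k})" for d
    by (intro card_mono) auto
  then have 2: "card {x \<in> box k. x - stp d \<notin> box k} \<le> 2 * k + 1" for d
    unfolding strip .
  show ?thesis using 1[of True] 1[of False] 2[of True] 2[of False] by (simp add: exits_def UNIV_bool)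
qed

text \<open>Two nontrivial constraints may concern the same two edges with source and target
  exchanged. As sources are distinct, the first cannot be related in this way to both others; and of
  two different pairs of edges, each contains an edge outside the other.\<close>

lemma indep_of_three:
  assumes "{c1, c2, c3} \<subseteq> links X" "distinct [c1, c2, c3]" "inj_on f X"
    and bad: "src f c1 \<noteq> tgt f c1" "src f c2 \<noteq> tgt f c2" "src f c3 \<noteq> tgt f c3"
  shows "\<exists>I\<subseteq>{c1, c2, c3}. card I = 2 \<and> indep f I"
proof -
  have src_inj: "src f c \<noteq> src f c'" if "c \<in> links X" "c' \<in> links X" "c \<noteq> c'" for c c'
    using that inj_onD[OF assms(3)] by (auto simp: links_def src_def)
  have s: "src f c1 \<noteq> src f c2" "src f c1 \<noteq> src f c3" "src f c2 \<noteq> src f c3"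
    using assms(1,2) by (intro src_inj; simp)+
  have pair: "indep f {c, c'}"
    if b: "src f c \<noteq> tgt f c" "src f c' \<noteq> tgt f c'" and d: "{src f c, tgt f c} \<noteq> {src f c', tgt f c'}"
    for c c'
  proof -
    obtain e e' where e: "e \<in> {src f c, tgt f c}" "e \<notin> {src f c', tgt f c'}"
      and e': "e' \<in> {src f c', tgt f c'}" "e' \<notin> {src f c, tgt f c}"
      using b d by (metis doubleton_eq_iff insert_iff singletonD)
    have "c \<noteq> c'" using d by blast
    then show ?thesis unfolding indep_def
      using b e e' by (intro exI[of _ "\<lambda>x. if x = c then e else e'"]) auto
  qed
  have "{src f c1, tgt f c1} \<noteq> {src f c2, tgt f c2} \<or> {src f c1, tgt f c1} \<noteq> {src f c3, tgt f c3}"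
    using s by (metis doubleton_eq_iff)
  then show ?thesis
  proof
    assume "{src f c1, tgt f c1} \<noteq> {src f c2, tgt f c2}"
    from pair[OF bad(1,2) this] assms(2) show ?thesis by (intro exI[of _ "{c1, c2}"]) auto
  next
    assume "{src f c1, tgt f c1} \<noteq> {src f c3, tgt f c3}"
    from pair[OF bad(1,3) this] assms(2) show ?thesis by (intro exI[of _ "{c1, c3}"]) auto
  qed
qed

section \<open>Certificates\<close>

text \<open>A path from the centre to \<open>\<alpha>\<close> without bad links would force
  \<open>f \<alpha> = f 0 + \<alpha>\<close>. The direct link and the detours around the two unit
  squares beside it share no link, which gives three nontrivial constraints.\<close>

lemma indep_near_wrong_neighbour:
  assumes inj: "inj_on f (box 1)" and \<alpha>: "\<alpha> \<in> directions" and wrong: "f \<alpha> \<noteq> f 0 + \<alpha>"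
  shows "\<exists>I\<subseteq>links (box 1). card I = 2 \<and> indep f I"
proof -
  define bad where "bad c \<longleftrightarrow> f (snd c + stp (fst c)) \<noteq> f (snd c) + stp (fst c)" for c
  have bad: "src f c \<noteq> tgt f c" if "bad c" for c
    using that unfolding bad_def src_def tgt_def by (metis Pair_inject diff_add_cancel)
  have paths: ?thesis
    if sub: "insert c (P \<union> Q) \<subseteq> links (box 1)" and dis: "c \<notin> P" "c \<notin> Q" "P \<inter> Q = {}"
      and ex: "bad c" "\<exists>c\<in>P. bad c" "\<exists>c\<in>Q. bad c" for c P Q
  proof -
    obtain c2 c3 where c: "c2 \<in> P" "bad c2" "c3 \<in> Q" "bad c3" using ex by blast
    have three: "{c, c2, c3} \<subseteq> links (box 1)" using c sub by blast
    have "distinct [c, c2, c3]" using c dis by auto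
    from indep_of_three[OF three this inj bad[OF ex(1)] bad[OF c(2)] bad[OF c(4)]]
    obtain I where "I \<subseteq> {c, c2, c3}" "card I = 2" "indep f I" by blast
    then show ?thesis using three by (intro exI[of _ I]) (simp add: subset_trans)
  qed
  note simps = bad_def links_def box_def stp_def zero_prod_def directions_def prod_eq_iff
  \<comment> \<open>Links point in positive directions, so for negative \<open>\<alpha>\<close> the
    direct link is based at \<open>\<alpha>\<close>.\<close>
  consider "\<alpha> = (1, 0)" | "\<alpha> = (-1, 0)" | "\<alpha> = (0, 1)" | "\<alpha> = (0, -1)"
    using \<alpha> by (auto simp: directions_def)
  then show ?thesis
  proof cases
    case 1
    show ?thesis
      by (rule paths[of "(True, 0, 0)" "{(False, 0, 0), (True, 0, 1), (False, 1, 0)}"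
            "{(False, 0, -1), (True, 0, -1), (False, 1, -1)}"]; use wrong 1 in \<open>force simp: simps\<close>)
  next
    case 2
    show ?thesis
      by (rule paths[of "(True, -1, 0)" "{(False, 0, 0), (True, -1, 1), (False, -1, 0)}"
            "{(False, 0, -1), (True, -1, -1), (False, -1, -1)}"]; use wrong 2 in \<open>force simp: simps\<close>)
  next
    case 3
    show ?thesis
      by (rule paths[of "(False, 0, 0)" "{(True, 0, 0), (False, 1, 0), (True, 0, 1)}"
            "{(True, -1, 0), (False, -1, 0), (True, -1, 1)}"]; use wrong 3 in \<open>force simp: simps\<close>)
  next
    case 4
    show ?thesis
      by (rule paths[of "(False, 0, -1)" "{(True, 0, 0), (False, 1, -1), (True, 0, -1)}"
            "{(True, -1, 0), (False, -1, -1), (True, -1, -1)}"]; use wrong 4 in \<open>force simp: simps\<close>)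
  qed
qed

text \<open>Here \<open>a j\<close> will count the cells of the box of radius \<open>j\<close>
  outside the giant cluster, and \<open>b j\<close> their exits. Each step adds more than
  \<open>2 * sqrt (a j) - 6\<close>, so the root grows by at least 1/2 once it has reached
  6.\<close>

lemma quadratic_growth:
  fixes a b :: "nat \<Rightarrow> nat"
  assumes a1: "a 1 \<ge> 1" and mono: "\<And>j. a (j - 1) \<le> a j"
    and step: "\<And>j. 1 \<le> j \<Longrightarrow> j \<le> k \<Longrightarrow> b j + a (j - 1) \<le> a j + 4"
    and strict: "\<And>j. 1 \<le> j \<Longrightarrow> j \<le> k \<Longrightarrow> b j > 0 \<Longrightarrow> a (j - 1) < a j"
    and large: "\<And>j. 1 \<le> j \<Longrightarrow> j \<le> k \<Longrightarrow> real (b j) > 2 * sqrt (real (a j)) - 2"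
    and k: "36 \<le> k"
  shows "((real k - 36) / 2)\<^sup>2 \<le> real (a k)"
proof -
  \<comment> \<open>For small \<open>a j\<close> the main estimate is void; strict growth brings
    \<open>a\<close> up to 36 by radius 36.\<close>
  have linear: "j \<le> a j" if "1 \<le> j" "j \<le> k" for j
    using that
  proof (induction j rule: dec_induct)
    case base
    then show ?case using a1 by simp
  next
    case (step j)
    have aj: "j \<le> a j" using step by simp
    have "a (Suc j - 1) \<le> a (Suc j)" by (rule mono)
    then have "1 \<le> sqrt (real (a (Suc j)))" using aj step(1) by simp
    moreover have "real (b (Suc j)) > 2 * sqrt (real (a (Suc j))) - 2"
      using large[of "Suc j"] step(4) by simp
    ultimately have "real (b (Suc j)) > 0" by linarith
    then have "b (Suc j) > 0" by simp
    then have "a j < a (Suc j)" using strict[of "Suc j"] step(4) by simp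
    then show ?case using aj by simp
  qed
  have "(real j - 36) / 2 \<le> sqrt (real (a j))" if "36 \<le> j" "j \<le> k" for j
    using that
  proof (induction j rule: dec_induct)
    case base
    then show ?case by simp
  next
    case (step j)
    let ?s = "sqrt (real (a (Suc j)))" and ?t = "sqrt (real (a j))"
    have "36 \<le> a (Suc j)" using linear[of "Suc j"] step by simp
    then have s6: "6 \<le> ?s" by (intro real_le_rsqrt) simp
    have "b (Suc j) + a j \<le> a (Suc j) + 4" using assms(3)[of "Suc j"] step by simp
    then have "real (b (Suc j)) + real (a j) \<le> real (a (Suc j)) + 4" by linarith
    moreover have "real (b (Suc j)) > 2 * ?s - 2" using large[of "Suc j"] step by simp
    \<comment> \<open>The left side is below \<open>?s\<^sup>2 - 2 * ?s + 6\<close>, and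
      \<open>6 \<le> ?s\<close>.\<close>
    ultimately have "real (a j) \<le> real (a (Suc j)) - ?s" using s6 by linarith
    also have "\<dots> = ?s\<^sup>2 - ?s" by simp
    also have "\<dots> \<le> (?s - 1/2)\<^sup>2" by (simp add: power2_eq_square algebra_simps)
    finally have "?t \<le> ?s - 1/2" using s6 by (intro real_le_lsqrt) auto
    then show ?case using step by (simp add: field_simps)
  qed
  from this[OF k order_refl] have "((real k - 36) / 2)\<^sup>2 \<le> (sqrt (real (a k)))\<^sup>2"
    using k by (intro power_mono) auto
  then show ?thesis by simp
qed

text \<open>A bound linear in \<open>a\<close> can be summed over the clusters; the gain is the
  slope above \<open>1 / L\<close>. It comes from \<open>sqrt a \<le> 49/50 * L\<close>, and for
  \<open>sqrt a \<ge> 200\<close> the slack \<open>sqrt a / 200\<close> pays for the 1. For smaller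
  \<open>a\<close> the shift by 40000 makes the left side negative.\<close>

lemma sqrt_ge_chord:
  fixes a L :: real
  assumes "L > 0" "1 \<le> a" "a \<le> 24/25 * L\<^sup>2"
  shows "203/200 / L * (a - 40000) \<le> sqrt a - 1"
proof (cases "a < 40000")
  case True
  then have "203/200 / L * (a - 40000) \<le> 0" using assms(1) by (intro mult_nonneg_nonpos) auto
  then show ?thesis using assms(2) by (smt (verit) real_sqrt_ge_one)
next
  case False
  let ?s = "sqrt a"
  have s: "200 \<le> ?s" using False by (intro real_le_rsqrt) simp
  have "?s \<le> 49/50 * L"
    by (rule real_le_lsqrt) (use assms in \<open>auto simp: power_mult_distrib power2_eq_square\<close>)
  then have "203/200 * ?s \<le> 199/200 * L" using assms(1) by simp
  then have "203/200 * ?s * ?s \<le> 199/200 * L * ?s" using s by (intro mult_right_mono) linarith+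
  moreover have "?s * ?s = a" using assms(2) by simp
  ultimately have "203/200 * a \<le> 199/200 * ?s * L" by (simp add: algebra_simps)
  then have "203/200 / L * a \<le> 199/200 * ?s" using assms(1) by (simp add: field_simps)
  moreover have "203/200 / L * (a - 40000) \<le> 203/200 / L * a"
    using assms(1) by (intro mult_left_mono) auto
  ultimately show ?thesis using s by linarith
qed

lemma certificate_of_clusters:
  assumes inj: "inj_on f (box k)" and j: "j \<le> k"
    and adj: "\<forall>x\<in>box k. \<forall>y\<in>box k. \<forall>d. f y = f x + stp d \<longrightarrow> \<kappa> x = \<kappa> y"
    and win: "\<forall>x y. \<kappa> x = \<kappa> y \<longrightarrow> f x - f y \<in> R"
    and A: "A \<subseteq> box j" and closed: "\<And>x y. x \<in> A \<Longrightarrow> y \<in> box j \<Longrightarrow> \<kappa> x = \<kappa> y \<Longrightarrow> y \<in> A"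
  shows "\<exists>D I. certificate k R f (box j) D I \<and> card D = card (\<kappa> ` box j) \<and>
    real (card I) \<ge> 2 * sqrt (real (card A)) - real (exits (box j) A)
      + 2 * (\<Sum>i\<in>\<kappa> ` A. sqrt (real (card {x \<in> A. \<kappa> x = i})))"
proof -
  note jk = box_mono[OF j]
  obtain D where D: "D \<subseteq> box j" "0 \<in> D" "card D = card (\<kappa> ` box j)"
    "\<forall>x\<in>box j. \<exists>d\<in>D. \<kappa> x = \<kappa> d"
    using exists_representatives[of 0 "box j" \<kappa>] by auto
  have "\<exists>I\<subseteq>links (box j). indep f I \<and>
    real (card I) \<ge> 2 * sqrt (real (card A)) - real (exits (box j) A)
      + 2 * (\<Sum>i\<in>\<kappa> ` A. sqrt (real (card {x \<in> A. \<kappa> x = i})))"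
  proof (rule exists_indep[OF finite_box A inj_on_subset[OF inj jk]])
    show "\<kappa> x = \<kappa> y" if "x \<in> box j" "y \<in> box j" "f y = f x + stp d" for x y d
      using adj that jk by blast
  qed (rule closed)
  then obtain I where I: "I \<subseteq> links (box j)" "indep f I"
    "real (card I) \<ge> 2 * sqrt (real (card A)) - real (exits (box j) A)
      + 2 * (\<Sum>i\<in>\<kappa> ` A. sqrt (real (card {x \<in> A. \<kappa> x = i})))" by blast
  have "\<forall>x\<in>box j. \<exists>d\<in>D. f x - f d \<in> R" using D(4) win by blast
  then have "certificate k R f (box j) D I"
    using I D jk by (simp add: certificate_def)
  then show ?thesis using I(3) D(3) by blast
qed

text \<open>The cluster sizes add up to L^2, so summing the linear bound gives
  \<open>m + 203/200 * L - 40600 * m / L\<close>; as there are few clusters, the loss is at most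
  \<open>3/200 * L\<close>.\<close>

lemma dense_clusters:
  fixes k :: nat and \<kappa> :: "vtx \<Rightarrow> 'a"
  defines "L \<equiv> real (2 * k + 1)" and "m \<equiv> real (card (\<kappa> ` box k))"
  assumes size: "\<And>i. i \<in> \<kappa> ` box k \<Longrightarrow> real (card {x \<in> box k. \<kappa> x = i}) \<le> 24/25 * L\<^sup>2"
    and few: "m \<le> L\<^sup>2 / 10^7"
  shows "m + L \<le> (\<Sum>i\<in>\<kappa> ` box k. sqrt (real (card {x \<in> box k. \<kappa> x = i})))"
proof -
  let ?a = "\<lambda>i. real (card {x \<in> box k. \<kappa> x = i})"
  have L: "L > 0" by (simp add: L_def)
  have "203/200 / L * (?a i - 40000) \<le> sqrt (?a i) - 1" if i: "i \<in> \<kappa> ` box k" for i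
  proof (rule sqrt_ge_chord[OF L _ size[OF i]])
    have "{x \<in> box k. \<kappa> x = i} \<noteq> {}" using i by blast
    then have "0 < card {x \<in> box k. \<kappa> x = i}" by (simp add: card_gt_0_iff)
    then show "1 \<le> ?a i" by linarith
  qed
  then have "(\<Sum>i\<in>\<kappa> ` box k. 203/200 / L * (?a i - 40000)) \<le> (\<Sum>i\<in>\<kappa> ` box k. sqrt (?a i) - 1)"
    by (rule sum_mono)
  also have "\<dots> = (\<Sum>i\<in>\<kappa> ` box k. sqrt (?a i)) - m" by (simp add: sum_subtractf m_def)
  also have "(\<Sum>i\<in>\<kappa> ` box k. 203/200 / L * (?a i - 40000)) = 203/200 / L * (L\<^sup>2 - 40000 * m)"
  proof -
    have "(\<Sum>i\<in>\<kappa> ` box k. card {x \<in> box k. \<kappa> x = i}) = card (box k)"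
      using sum.group[of "box k" "\<kappa> ` box k" \<kappa> "\<lambda>_. 1 :: nat"] by simp
    then have "(\<Sum>i\<in>\<kappa> ` box k. ?a i) = L\<^sup>2"
      by (simp add: card_box L_def flip: of_nat_sum)
    then have "(\<Sum>i\<in>\<kappa> ` box k. ?a i - 40000) = L\<^sup>2 - 40000 * m"
      by (simp add: sum_subtractf m_def)
    then show ?thesis by (simp only: flip: sum_distrib_left)
  qed
  finally have "203/200 / L * (L\<^sup>2 - 40000 * m) + m \<le> (\<Sum>i\<in>\<kappa> ` box k. sqrt (?a i))" by simp
  moreover have "L \<le> 203/200 / L * (L\<^sup>2 - 40000 * m)"
  proof -
    have "10000000 * m \<le> L\<^sup>2" using few by simp
    moreover have "0 \<le> L\<^sup>2" "0 \<le> m" by (simp_all add: m_def)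
    ultimately have "8120000 * m \<le> 3 * L\<^sup>2" by linarith
    then have "L\<^sup>2 \<le> 203/200 * (L\<^sup>2 - 40000 * m)" by simp
    then show ?thesis using L by (simp add: field_simps power2_eq_square)
  qed
  ultimately show ?thesis by linarith
qed

text \<open>\<open>2 * d \<le> r\<close> absorbs the cost of placement and leaves
  \<open>- 2 - \<epsilon> * r\<close>, for which a single constraint suffices.\<close>

lemma exponent_le:
  fixes d r \<epsilon> :: real
  assumes "2 * d \<le> r" "1 \<le> r" "0 < \<epsilon>"
  shows "2 * (d - 1) - (1 + \<epsilon>) * r \<le> - 2 - \<epsilon> / 2"
proof -
  have "2 * (d - 1) - (1 + \<epsilon>) * r = 2 * d - 2 - r - \<epsilon> * r" by (simp add: algebra_simps)
  moreover have "\<epsilon> \<le> \<epsilon> * r" using assms(2,3) by simp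
  ultimately show ?thesis using assms by linarith
qed

lemma exists_certificate:
  assumes inj: "inj_on f (box k)" and \<alpha>: "\<alpha> \<in> directions" and wrong: "f \<alpha> \<noteq> f 0 + \<alpha>"
    and \<epsilon>: "\<epsilon> > 0" and k\<epsilon>: "real k \<ge> 10^30 / \<epsilon>"
  shows "\<exists>X D I. certificate k (window ((card (box k))\<^sup>2)) f X D I \<and>
    2 * (real (card D) - 1) - (1 + \<epsilon>) * real (card I) \<le> - 2 - \<epsilon> / 2"
proof -
  define L where "L = real (2 * k + 1)"
  define R where "R = window ((card (box k))\<^sup>2)"
  have k1: "1 \<le> k"
  proof (rule ccontr)
    assume "\<not> 1 \<le> k"
    then have "k = 0" by simp
    then show False using k\<epsilon> \<epsilon> by (simp add: divide_le_0_iff)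
  qed
  have cB: "real (card (box k)) = L\<^sup>2" by (simp add: card_box L_def)
  obtain \<kappa> :: "vtx \<Rightarrow> vtx set"
    where adj: "\<forall>x\<in>box k. \<forall>y\<in>box k. \<forall>d. f y = f x + stp d \<longrightarrow> \<kappa> x = \<kappa> y"
      and win: "\<forall>x y. \<kappa> x = \<kappa> y \<longrightarrow> f x - f y \<in> R"
    using exists_clusters[of "box k" f] unfolding R_def by auto
  have R0: "f x - f x \<in> R" for x using win by blast
  obtain I0 where I0: "I0 \<subseteq> links (box 1)" "card I0 = 2" "indep f I0"
    using indep_near_wrong_neighbour[OF inj_on_subset[OF inj box_mono[OF k1]] \<alpha> wrong] by blast
  let ?goal = "\<exists>X D I. certificate k R f X D I \<and>
    2 * (real (card D) - 1) - (1 + \<epsilon>) * real (card I) \<le> - 2 - \<epsilon> / 2"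
  \<comment> \<open>For huge \<open>\<epsilon>\<close>, two constraints pay even for placing every
    cell freely.\<close>
  have small_k: ?goal if "\<epsilon> \<ge> 4 * L\<^sup>2"
  proof -
    have "certificate k R f (box k) (box k) I0"
      unfolding certificate_def
      using I0 R0 links_mono[OF box_mono[OF k1]] zero_in_box[of k] by blast
    moreover have "2 * (real (card (box k)) - 1) - (1 + \<epsilon>) * real (card I0) \<le> - 2 - \<epsilon> / 2"
      using that \<epsilon> by (simp add: cB I0)
    ultimately show ?thesis by blast
  qed
  \<comment> \<open>Now \<open>\<epsilon> < 4 * L\<^sup>2\<close> and
    \<open>k * \<epsilon> \<ge> 10^30\<close> force \<open>L\<close> to be large.\<close>
  have large_k: ?goal if big: "\<epsilon> < 4 * L\<^sup>2"
  proof -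
    have Lk: "L = 2 * real k + 1" by (simp add: L_def)
    have \<epsilon>k: "10^30 \<le> real k * \<epsilon>" using k\<epsilon> \<epsilon> by (simp add: field_simps)
    also have "\<dots> \<le> L / 2 * (4 * L\<^sup>2)"
      using big \<epsilon> by (intro mult_mono) (auto simp: Lk)
    finally have L3: "10^30 \<le> 2 * L^3" by (simp add: power2_eq_square power3_eq_cube)
    have L9: "10^9 \<le> L"
    proof (rule ccontr)
      assume "\<not> 10^9 \<le> L"
      then have "L^3 \<le> (10^9)^3" by (intro power_mono) (auto simp: L_def)
      then show False using L3 by simp
    qed
    show ?goal
    proof (cases "\<exists>i\<in>\<kappa> ` box k. real (card {x \<in> box k. \<kappa> x = i}) > 24/25 * L\<^sup>2")
      case False
      let ?S = "\<Sum>i\<in>\<kappa> ` box k. sqrt (real (card {x \<in> box k. \<kappa> x = i}))"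
      define m where "m = real (card (\<kappa> ` box k))"
      obtain D I where cert: "certificate k R f (box k) D I" and D: "card D = card (\<kappa> ` box k)"
        and I: "real (card I) \<ge> 2 * sqrt (real (card (box k))) - real (exits (box k) (box k)) + 2 * ?S"
        using certificate_of_clusters[OF inj order_refl adj win order_refl] by blast
      define r where "r = real (card I)"
      have "real (exits (box k) (box k)) \<le> real (4 * (2 * k + 1))"
        by (simp only: of_nat_le_iff exits_full_box)
      then have r: "r \<ge> 2 * ?S - 2 * L" using I cB by (simp add: r_def L_def)
      have "m \<le> ?S"
      proof -
        have "1 \<le> sqrt (real (card {x \<in> box k. \<kappa> x = i}))" if "i \<in> \<kappa> ` box k" for i
        proof -
          have "{x \<in> box k. \<kappa> x = i} \<noteq> {}" using that by blast
          then have "0 < card {x \<in> box k. \<kappa> x = i}" by (simp add: card_gt_0_iff)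
          then show ?thesis by simp
        qed
        from sum_mono[of "\<kappa> ` box k" "\<lambda>_. 1", OF this] show ?thesis by (simp add: m_def)
      qed
      have "2 * (m - 1) - (1 + \<epsilon>) * r \<le> - 2 - \<epsilon> / 2"
      proof (cases "\<epsilon> * r \<ge> 4 * L")
        case True
        then have "r \<noteq> 0" using L9 by auto
        then have "1 \<le> r" unfolding r_def by simp
        then have "\<epsilon> \<le> \<epsilon> * r" using \<epsilon> by simp
        \<comment> \<open>Since \<open>2 * m \<le> r + 2 * L\<close>, half of
          \<open>\<epsilon> * r\<close> makes up for \<open>2 * L\<close> and the other half leaves
          \<open>\<epsilon> / 2\<close>.\<close>
        then show ?thesis using True r \<open>m \<le> ?S\<close> by (simp add: algebra_simps)
      next
        case False
        \<comment> \<open>From \<open>\<epsilon> * r < 4 * L\<close> and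
          \<open>k * \<epsilon> \<ge> 10^30\<close>, \<open>r\<close> is a tiny fraction of L^2, and
          so is the number of clusters.\<close>
        have "10^30 * r \<le> real k * \<epsilon> * r" using \<epsilon>k by (intro mult_right_mono) (auto simp: r_def)
        also have "\<dots> \<le> real k * (4 * L)"
          using False by (simp add: mult.assoc mult_left_mono)
        also have "\<dots> \<le> L / 2 * (4 * L)" by (intro mult_right_mono) (auto simp: Lk)
        finally have "500000000000000000000000000000 * r \<le> L\<^sup>2" by (simp add: power2_eq_square)
        moreover have "1000000000 * L \<le> L\<^sup>2" using L9 by (simp add: power2_eq_square)
        moreover have "0 \<le> L\<^sup>2" "0 \<le> r" by (simp_all add: r_def)
        moreover have "2 * m \<le> r + 2 * L" using r \<open>m \<le> ?S\<close> by linarith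
        ultimately have "10000000 * m \<le> L\<^sup>2" by linarith
        then have "m \<le> L\<^sup>2 / 10^7" by simp
        then have "m + L \<le> ?S"
          unfolding m_def L_def by (intro dense_clusters) (use \<open>\<not> (\<exists>i\<in>_. _)\<close> in \<open>auto simp: L_def not_less\<close>)
        then have r2: "2 * m \<le> r" using r by linarith
        have "\<kappa> ` box k \<noteq> {}" using zero_in_box by blast
        then have "0 < card (\<kappa> ` box k)" by (simp add: card_gt_0_iff)
        then have "1 \<le> m" by (simp add: m_def)
        then show ?thesis using r2 by (intro exponent_le \<epsilon>) auto
      qed
      then show ?thesis using cert D unfolding r_def m_def by metis
    next
      case True
      then obtain i0 where giant: "real (card {x \<in> box k. \<kappa> x = i0}) > 24/25 * L\<^sup>2" by blast
      define V where "V = {x \<in> box k. \<kappa> x \<noteq> i0}"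
      show ?thesis
      proof (cases "V \<inter> box 1 = {}")
        case True
        have one: "\<kappa> x = i0" if "x \<in> box 1" for x
          using True that box_mono[OF k1] by (auto simp: V_def)
        \<comment> \<open>The giant cluster covers the whole box of radius 1, so the centre is the
          only representative and nothing remains to be placed.\<close>
        have "f x - f 0 \<in> R" if "x \<in> box 1" for x
          by (rule win[rule_format]) (simp only: one[OF that] one[OF zero_in_box])
        then have "certificate k R f (box 1) {0} I0"
          using I0 box_mono[OF k1] by (simp add: certificate_def)
        moreover have "2 * (real (card {0 :: vtx}) - 1) - (1 + \<epsilon>) * real (card I0) \<le> - 2 - \<epsilon> / 2"
          using \<epsilon> by (simp add: I0)
        ultimately show ?thesis by blast
      next
        case False
        define A where "A j = V \<inter> box j" for j
        have finA: "finite (A j)" for j by (simp add: A_def)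
        have A_prev: "A j \<inter> box (j - 1) = A (j - 1)" for j
          using box_mono[of "j - 1" j] by (auto simp: A_def)
        have "\<exists>j. 1 \<le> j \<and> j \<le> k \<and> real (exits (box j) (A j)) \<le> 2 * sqrt (real (card (A j))) - 2"
        proof (rule ccontr)
          assume no: "\<not> ?thesis"
          have "((real k - 36) / 2)\<^sup>2 \<le> real (card (A k))"
          proof (rule quadratic_growth[where b = "\<lambda>j. exits (box j) (A j)"])
            show "1 \<le> card (A 1)"
              using False finA by (simp add: A_def Suc_le_eq card_gt_0_iff)
            show "card (A (j - 1)) \<le> card (A j)" for j
              using A_prev by (intro card_mono finA) blast
            show "exits (box j) (A j) + card (A (j - 1)) \<le> card (A j) + 4" if "1 \<le> j" for j
              using exits_box_le[of "A j" j, unfolded A_prev] that by (simp add: A_def)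
            show "card (A (j - 1)) < card (A j)" if "1 \<le> j" "exits (box j) (A j) > 0" for j
            proof (rule psubset_card_mono[OF finA])
              have "\<not> A j \<subseteq> box (j - 1)" using exits_box_interior[of "A j" j] that by auto
              then show "A (j - 1) \<subset> A j" using A_prev[of j] by blast
            qed
            show "real (exits (box j) (A j)) > 2 * sqrt (real (card (A j))) - 2" if "1 \<le> j" "j \<le> k" for j
              using no that by force
            show "36 \<le> k" using L9 by (simp add: L_def)
          qed
          moreover have "real (card (A k)) \<le> L\<^sup>2 / 25"
          proof -
            have "card (A k) + card {x \<in> box k. \<kappa> x = i0} = card (A k \<union> {x \<in> box k. \<kappa> x = i0})"
              by (rule card_Un_disjoint[symmetric]) (auto simp: A_def V_def)
            also have "\<dots> \<le> card (box k)" by (rule card_mono) (auto simp: A_def)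
            finally have "real (card (A k)) + real (card {x \<in> box k. \<kappa> x = i0}) \<le> L\<^sup>2"
              using cB by linarith
            then show ?thesis using giant by simp
          qed
          \<comment> \<open>Growth yields about \<open>L\<^sup>2 / 16\<close> cells, against the
            \<open>L\<^sup>2 / 25\<close> left by the giant cluster; the gap absorbs the 36.\<close>
          moreover have "L\<^sup>2 / 25 < ((real k - 36) / 2)\<^sup>2"
          proof -
            have "(L / 5)\<^sup>2 < ((real k - 36) / 2)\<^sup>2"
              by (rule power_strict_mono) (use L9 Lk in auto)
            then show ?thesis by (simp add: power_divide)
          qed
          ultimately show False by linarith
        qed
        then obtain j where j: "1 \<le> j" "j \<le> k"
          and exits_j: "real (exits (box j) (A j)) \<le> 2 * sqrt (real (card (A j))) - 2" by blast
        have closed: "y \<in> A j" if "x \<in> A j" "y \<in> box j" "\<kappa> x = \<kappa> y" for x y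
          using that box_mono[OF j(2)] by (auto simp: A_def V_def)
        have Aj: "A j \<subseteq> box j" by (simp add: A_def)
        let ?S = "\<Sum>i\<in>\<kappa> ` A j. sqrt (real (card {x \<in> A j. \<kappa> x = i}))"
        obtain D I where cert: "certificate k R f (box j) D I" and D: "card D = card (\<kappa> ` box j)"
          and I: "real (card I) \<ge> 2 * sqrt (real (card (A j))) - real (exits (box j) (A j)) + 2 * ?S"
          using certificate_of_clusters[of f k j \<kappa> R "A j", OF inj j(2) adj win Aj] closed by blast
        define m where "m = real (card (\<kappa> ` A j))"
        have "m \<le> ?S"
        proof -
          have "1 \<le> sqrt (real (card {x \<in> A j. \<kappa> x = i}))" if "i \<in> \<kappa> ` A j" for i
          proof -
            have "{x \<in> A j. \<kappa> x = i} \<noteq> {}" using that by blast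
            then have "0 < card {x \<in> A j. \<kappa> x = i}" using finA by (simp add: card_gt_0_iff)
            then show ?thesis by simp
          qed
          from sum_mono[of "\<kappa> ` A j" "\<lambda>_. 1", OF this] show ?thesis by (simp add: m_def)
        qed
        \<comment> \<open>The surplus 2 pays for one extra representative: the box of radius
          \<open>j\<close> meets the clusters of \<open>A j\<close> and at most the giant one
          besides.\<close>
        then have I2: "real (card I) \<ge> 2 + 2 * m" using I exits_j by linarith
        have "card (\<kappa> ` box j) \<le> card (insert i0 (\<kappa> ` A j))"
          using box_mono[OF j(2)] finA by (intro card_mono) (auto simp: A_def V_def)
        also have "\<dots> \<le> card (\<kappa> ` A j) + 1" using finA by (simp add: card_insert_if)
        finally have D2: "real (card D) - 1 \<le> m" unfolding D m_def by linarith
        have "2 * (real (card D) - 1) - (1 + \<epsilon>) * real (card I) \<le> - 2 - \<epsilon> / 2"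
          by (rule exponent_le[OF _ _ \<epsilon>]) (use I2 D2 in \<open>simp_all add: m_def\<close>)
        then show ?thesis using cert by blast
      qed
    qed
  qed
  show ?thesis using small_k large_k unfolding R_def by (cases "\<epsilon> \<ge> 4 * L\<^sup>2") auto
qed

theorem theorem2p1:
  shows "\<exists>c::real. c > 0 \<and>
    (\<forall>k::nat. \<exists>C::real. \<forall>\<epsilon>::real. \<epsilon> > 0 \<and> real k \<ge> c / \<epsilon> \<longrightarrow>
      (\<forall>n q :: nat. n \<ge> 1 \<and> q \<ge> 1 \<and> real q \<ge> real n powr (1 + \<epsilon>) \<longrightarrow>
        (\<forall>v \<in> grid n. \<forall>\<alpha> \<in> directions.
          puzzle_prob n q (\<lambda>\<sigma>. \<exists>f \<in> Sk n k \<sigma> v. f \<alpha> \<noteq> (fst v + fst \<alpha>, snd v + snd \<alpha>))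
            \<le> C * real n powr (-2 - \<epsilon> / 2))))"
proof -
  define R where "R k = window ((card (box k))\<^sup>2)" for k
  define C where "C k = real (card (Pow (box k) \<times> Pow (box k) \<times> Pow (links (box k)))) *
    real ((card (box k) * card (R k)) ^ card (box k))" for k
  have main: "puzzle_prob n q (\<lambda>\<sigma>. \<exists>f \<in> Sk n k \<sigma> v. f \<alpha> \<noteq> (fst v + fst \<alpha>, snd v + snd \<alpha>))
      \<le> C k * real n powr (-2 - \<epsilon> / 2)"
    if \<epsilon>: "\<epsilon> > 0" and k: "real k \<ge> 10^30 / \<epsilon>" and n: "n \<ge> 1" and q: "q \<ge> 1"
      and qn: "real q \<ge> real n powr (1 + \<epsilon>)" and \<alpha>: "\<alpha> \<in> directions" for k \<epsilon> n q v \<alpha>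
    unfolding C_def
  proof (rule puzzle_prob_le[OF _ _ q])
    show "finite (R k)" "R k \<noteq> {}" by (auto simp: R_def window_def)
    show "0 \<le> real n powr (-2 - \<epsilon> / 2)" by simp
    fix \<sigma> f assume f: "f \<in> Sk n k \<sigma> v" and wrong: "f \<alpha> \<noteq> (fst v + fst \<alpha>, snd v + snd \<alpha>)"
    have "inj_on f (box k)" "f \<alpha> \<noteq> f 0 + \<alpha>"
      using f wrong by (auto simp: Sk_def zero_prod_def plus_prod_def)
    from exists_certificate[OF this(1) \<alpha> this(2) \<epsilon> k]
    obtain X D I where cert: "certificate k (R k) f X D I"
      and ex: "2 * (real (card D) - 1) - (1 + \<epsilon>) * real (card I) \<le> - 2 - \<epsilon> / 2"
      unfolding R_def by blast
    have "finite D" "D \<noteq> {}"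
      using cert finite_subset[OF _ finite_box] by (auto simp: certificate_def)
    then have D: "1 \<le> card D" by (simp add: Suc_le_eq card_gt_0_iff)
    have "real n ^ (2 * (card D - 1)) = real n powr (2 * (real (card D) - 1))"
      using n D by (simp add: of_nat_diff flip: powr_realpow)
    also have "\<dots> \<le> real n powr (- 2 - \<epsilon> / 2 + (1 + \<epsilon>) * real (card I))"
      using n ex by (intro powr_mono) auto
    \<comment> \<open>The bound is split so that each factor \<open>n powr (1 + \<epsilon>)\<close>
      can be replaced by \<open>q\<close>.\<close>
    also have "\<dots> = real n powr (- 2 - \<epsilon> / 2) * (real n powr (1 + \<epsilon>)) ^ card I"
      using n by (subst powr_add) (simp add: powr_powr flip: powr_realpow del: powr_add)
    also have "\<dots> \<le> real n powr (- 2 - \<epsilon> / 2) * real q ^ card I"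
      using qn by (intro mult_left_mono power_mono) auto
    finally show "\<exists>X D I. certificate k (R k) f X D I \<and>
      real n ^ (2 * (card D - 1)) \<le> real n powr (- 2 - \<epsilon> / 2) * real q ^ card I"
      using cert by blast
  qed
  \<comment> \<open>\<open>C k\<close> involves neither \<open>\<epsilon>\<close> nor
    \<open>n\<close> nor \<open>q\<close>, so it can be chosen before them.\<close>
  show ?thesis
    by (rule exI[of _ "10^30"], intro conjI allI, simp, rule_tac x = "C k" in exI) (use main in blast)
qed

end
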